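(* Let $m,n$ be positive integers with $n\ge m$, and let $$\Theta_1=\sum_{k=1}^\infty \frac{\psi\left(\frac{2k+2n+5}{4}\right)-\psi\left(\frac{2k+2n+3}{4}\right)}{(2k+2m+1)^2}.$$ Then: (i) if $n=m$: $$\Theta_1=-4-4\sum_{k=1}^{m}\sum_{j=0}^{k}\frac{(-1)^{j+k}}{(2j+1)(2k+1)^2}+\left(1+\sum_{j=1}^{m}\frac{(-1)^j}{(2j+1)^2}-G\right)\pi+\frac{\pi^2}{4}\ln 2+\frac74\zeta(3);$$ (ii) if $n=m+1$: $$\Theta_1=\frac53+4\sum_{k=1}^{m}\sum_{j=0}^{k+1}\frac{(-1)^{j+k}}{(2j+1)(2k+1)^2}-\left(1+\sum_{j=1}^{m}\frac{(-1)^j}{(2j+1)^2}-G\right)\pi+\frac{\pi^2}{4}(1-\ln 2)-\frac74\zeta(3);$$ (iii) if $n=m+2$: $$\Theta_1=-\frac{14}{5}-4\sum_{k=1}^{m}\sum_{j=0}^{k+2}\frac{(-1)^{j+k}}{(2j+1)(2k+1)^2}+\left(1+\sum_{j=1}^{m}\frac{(-1)^j}{(2j+1)^2}-G\right)\pi+\left(\ln 2-\frac12\right)\frac{\pi^2}{4}+\frac74\zeta(3);$$ (iv) if $n-m$ is odd and $n-m\neq1$: $$\begin{aligned}\Theta_1={}&3-\frac18\sum_{j=1}^{\frac{n-m-1}{2}}\frac{(4j+1)(H_{2j-1}-2H_{4j-1})}{j^2(2j+1)^2}-\sum_{j=1}^{\frac{n-m-1}{2}}\frac{1}{(2j+1)^2(4j+1)}-4\sum_{k=1}^{m}\sum_{j=0}^{k+n-m}\frac{(-1)^{k+n-m+j}}{(2k+1)^2(2j+1)}\\&+4\sum_{j=1}^{n-m}\frac{(-1)^j}{2j+1}+\left(-1-\sum_{j=1}^{m}\frac{(-1)^{j+n-m-1}}{(2j+1)^2}+G\right)\pi+\left(1-\ln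 2-\frac12\sum_{j=1}^{\frac{n-m-1}{2}}\frac{1}{j(2j+1)}\right)\frac{\pi^2}{4}-\frac74\zeta(3);\end{aligned}$$ (v) if $n-m$ is even and $n-m\ge4$: $$\begin{aligned}\Theta_1={}&-\frac{10}{3}-\frac18\sum_{j=1}^{\frac{n-m-2}{2}}\frac{(4j+3)(H_{2j-1}-2H_{4j-1})}{(j+1)^2(2j+1)^2}-\sum_{j=1}^{\frac{n-m-2}{2}}\frac{4j^3+j^2-4j-2}{(j+1)^2(2j+1)^2(4j+3)(4j+1)}\\&-4\sum_{k=1}^{m}\sum_{j=0}^{k+n-m}\frac{(-1)^{k+n-m+j}}{(2k+1)^2(2j+1)}-4\sum_{j=1}^{n-m}\frac{(-1)^j}{2j+1}-\left(-1+\sum_{j=1}^{m}\frac{(-1)^{j+n-m-1}}{(2j+1)^2}+G\right)\pi\\&+\frac{\pi^2}{4}\left(\ln 2-\frac12\right)-\frac{\pi^2}{8}\sum_{j=1}^{\frac{n-m-2}{2}}\frac{1}{(j+1)(2j+1)}+\frac74\zeta(3).\end{aligned}$$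
   Context: $\psi=\Gamma'/\Gamma$ is the digamma function, $H_n=\sum_{k=1}^n\frac1k$ the $n$-th harmonic number, $G=\sum_{k=0}^\infty\frac{(-1)^k}{(2k+1)^2}$ is Catalan's constant, $\zeta$ is the Riemann zeta function. *)

theory Defs
  imports "HOL-Analysis.Analysis"
begin

definition catalan_G :: real where
  "catalan_G = (\<Sum>k. (-1) ^ k / (2 * real k + 1)\<^sup>2)"

(* Dirichlet series of the Riemann zeta function; meaningful for real s > 1 only. *)
definition zeta :: "real \<Rightarrow> real" where
  "zeta s = (\<Sum>k. 1 / real (Suc k) powr s)"

lemma summable_catalan_G: "summable (\<lambda>k. (-1) ^ k / (2 * real k + 1)\<^sup>2)"
proof (rule summable_comparison_test')
  show "summable (\<lambda>k. inverse (real (Suc k) ^ 2))"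
    by (subst summable_Suc_iff[of "\<lambda>k. inverse (real k ^ 2)"]) (rule inverse_power_summable, simp)
  show "norm ((-1) ^ k / (2 * real k + 1)\<^sup>2 :: real) \<le> inverse (real (Suc k) ^ 2)" for k
    by (simp add: norm_divide norm_power inverse_eq_divide frac_le power_mono)
qed

lemma summable_zeta:
  assumes "s > 1"
  shows "summable (\<lambda>k. 1 / real (Suc k) powr s)"
proof -
  have "summable (\<lambda>k. real k powr (- s))"
    using assms by (simp add: summable_real_powr_iff)
  then have "summable (\<lambda>k. real (Suc k) powr (- s))"
    by (rule summable_ignore_initial_segment[of _ 1, simplified])
  then show ?thesis
    by (simp only: powr_minus inverse_eq_divide)
qed

(* The k-th term of Theta_1(m,n); the series runs over k \<ge> 1. *)
definition Theta1_term :: "nat \<Rightarrow> nat \<Rightarrow> nat \<Rightarrow> real" where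
  "Theta1_term m n k =
     (Digamma ((2 * real k + 2 * real n + 5) / 4) - Digamma ((2 * real k + 2 * real n + 3) / 4))
       / (2 * real k + 2 * real m + 1)\<^sup>2"

end

theory Submission
  imports Defs "HOL-Real_Asymp.Real_Asymp"
begin

text \<open>
  The digamma difference in the \<open>k\<close>-th term is \<open>4\<beta>(k + n + 1)\<close>, where
  \<open>\<beta>(N) = \<Sum>\<^sub>j (-1)\<^sup>j/(2N + 2j + 1)\<close> is a signed tail of the Leibniz series. The recurrence
  \<open>\<beta>(N) + \<beta>(N + 1) = 1/(2N + 1)\<close> reduces everything to \<open>T = \<Sum>\<^sub>p \<beta>(p + 1)/(2p + 1)\<^sup>2\<close>, the
  remaining sums being elementary by partial fractions. To evaluate \<open>T\<close>, let
  \<open>W = \<Sum> (-1)\<^sup>q/(ab(a + b))\<close> over \<open>a = 2p + 1\<close>, \<open>b = 2q + 2\<close> and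
  \<open>Y = \<Sum> (-1)\<^bsup>p + q\<^esup>/(ab(a + b))\<close> over \<open>a = 2p + 1\<close>, \<open>b = 2q + 1\<close>. Both converge
  absolutely, and expanding \<open>1/(ab(a + b))\<close> by partial fractions along rows, columns and
  diagonals gives \<open>T = \<pi>\<^sup>2 ln 2/16 - W\<close>, \<open>Y = 2W\<close> and a linear relation between \<open>W\<close>, \<open>Y\<close>
  and \<open>T\<close> that forces \<open>2W = \<pi>G/2 - 7\<zeta>(3)/8\<close>.
\<close>

section \<open>Double series: rearrangement and absolute convergence\<close>

text \<open>Fubini for unconditionally summable families: one value \<open>S\<close> serves all
  three orders of summation. The rules for rows and columns accept any values established with
  \<open>sums\<close>, so conditionally convergent pieces may be used to compute them.\<close>

lemma double_sums:
  fixes f :: "nat \<Rightarrow> nat \<Rightarrow> real"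
  assumes summ: "(\<lambda>(p, q). f p q) summable_on UNIV"
  obtains S where
    "\<And>r. (\<And>p. f p sums r p) \<Longrightarrow> r sums S"
    "\<And>c. (\<And>q. (\<lambda>p. f p q) sums c q) \<Longrightarrow> c sums S"
    "(\<lambda>n. \<Sum>p\<le>n. f p (n - p)) sums S"
proof
  define S where "S = infsum (\<lambda>(p, q). f p q) UNIV"
  have hs: "((\<lambda>(p, q). f p q) has_sum S) (UNIV \<times> UNIV)"
    using has_sum_infsum[OF summ] by (simp add: S_def)
  have row: "f p summable_on UNIV" for p
  proof -
    have "(\<lambda>(p, q). f p q) summable_on ({p} \<times> UNIV)"
      by (rule summable_on_subset_banach[OF summ]) auto
    then show ?thesis
      using summable_on_SigmaD1[where f = f and A = "{p}" and B = "\<lambda>_. UNIV"] by simp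
  qed
  have hs': "((\<lambda>(q, p). f p q) has_sum S) (UNIV \<times> UNIV)"
    using hs has_sum_swap[where f = "\<lambda>(p, q). f p q" and A = UNIV and B = UNIV] by (simp add: case_prod_unfold)
  have col: "(\<lambda>p. f p q) summable_on UNIV" for q
  proof -
    have "(\<lambda>(q, p). f p q) summable_on UNIV"
      using hs' by (auto simp: summable_on_def)
    then have "(\<lambda>(q, p). f p q) summable_on ({q} \<times> UNIV)"
      by (rule summable_on_subset_banach) auto
    then show ?thesis
      using summable_on_SigmaD1[where f = "\<lambda>q p. f p q" and A = "{q}" and B = "\<lambda>_. UNIV"] by simp
  qed
  show "r sums S" if "\<And>p. f p sums r p" for r
  proof (rule has_sum_imp_sums, rule has_sum_SigmaD[OF hs])
    \<comment> \<open>The hypothesis on \<open>r\<close> is only an ordered sum. Since the row is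
      unconditionally summable, uniqueness of limits identifies \<open>r p\<close> with its
      \<open>infsum\<close>.\<close>
    show "((\<lambda>q. case (p, q) of (p, q) \<Rightarrow> f p q) has_sum r p) UNIV" for p
      using has_sum_infsum[OF row[of p]] has_sum_imp_sums sums_unique2 that[of p] by fastforce
  qed
  show "c sums S" if "\<And>q. (\<lambda>p. f p q) sums c q" for c
  proof (rule has_sum_imp_sums, rule has_sum_SigmaD[OF hs'])
    show "((\<lambda>p. case (q, p) of (q, p) \<Rightarrow> f p q) has_sum c q) UNIV" for q
      using has_sum_infsum[OF col[of q]] has_sum_imp_sums sums_unique2 that[of q] by fastforce
  qed
  \<comment> \<open>Diagonals are the reindexing of the quadrant by
    \<open>(p, q) \<mapsto> (p + q, p)\<close>; each of them is finite.\<close>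
  have "((\<lambda>(n, p). f p (n - p)) has_sum S) (SIGMA n:UNIV. {..n})"
    using hs
    by (subst has_sum_reindex_bij_witness[where j = "\<lambda>(n, p). (p, n - p)" and i = "\<lambda>(p, q). (p + q, p)"
          and T = "UNIV \<times> UNIV" and h = "\<lambda>(p, q). f p q" and s' = S]) auto
  then have "((\<lambda>n. \<Sum>p\<le>n. f p (n - p)) has_sum S) UNIV"
  proof (rule has_sum_SigmaD)
    show "((\<lambda>p. case (n, p) of (n, p) \<Rightarrow> f p (n - p)) has_sum (\<Sum>p\<le>n. f p (n - p))) {..n}" for n
      by (simp add: has_sum_finite)
  qed
  then show "(\<lambda>n. \<Sum>p\<le>n. f p (n - p)) sums S"
    by (rule has_sum_imp_sums)
qed

text \<open>With \<open>a = p + 1\<close> and \<open>b = q + 1\<close>, the third factor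
  \<open>a + b - 1\<close> is at least \<open>sqrt (a * b)\<close>. The bound is therefore at most
  \<open>(a * b) powr (-3/2)\<close>, a product of two convergent single series.\<close>

lemma summable_on_inverse_product_sum:
  fixes f :: "nat \<Rightarrow> nat \<Rightarrow> real"
  assumes "\<And>p q. \<bar>f p q\<bar> \<le> 1 / ((real p + 1) * (real q + 1) * (real p + real q + 1))"
  shows "(\<lambda>(p, q). f p q) summable_on UNIV"
proof -
  define g where "g p = (real p + 1) powr (- (3 / 2))" for p
  have "summable (\<lambda>p. real p powr (- (3 / 2)))"
    by (simp add: summable_real_powr_iff)
  then have "summable g"
    using summable_ignore_initial_segment[of "\<lambda>p. real p powr (- (3 / 2))" 1]
    by (simp add: g_def[abs_def] add.commute)
  then have g: "g summable_on UNIV"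
    by (intro norm_summable_imp_summable_on) (simp add: g_def[abs_def])
  have "(\<lambda>(p, q). g p * g q) summable_on UNIV \<times> UNIV"
  proof (rule summable_on_SigmaI)
    show "((\<lambda>q. case (p, q) of (p, q) \<Rightarrow> g p * g q) has_sum (g p * infsum g UNIV)) UNIV" for p
      using has_sum_cmult_right[OF has_sum_infsum[OF g], of "g p"] by simp
    show "(\<lambda>p. g p * infsum g UNIV) summable_on UNIV"
      by (rule summable_on_cmult_left[OF g])
  qed (simp add: g_def)
  then have "(\<lambda>x. norm (case x of (p, q) \<Rightarrow> g p * g q)) summable_on UNIV \<times> UNIV"
    by (rule summable_on_cong[THEN iffD1, rotated]) (auto simp: g_def)
  then have "(\<lambda>x. norm (case x of (p, q) \<Rightarrow> f p q)) summable_on UNIV \<times> UNIV"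
  proof (rule Infinite_Sum.abs_summable_on_comparison_test)
    fix x :: "nat \<times> nat"
    obtain p q where x: "x = (p, q)" by force
    have xy: "a powr (- (3 / 2)) * b powr (- (3 / 2)) \<ge> 1 / (a * b * (a + b - 1))"
      if "a \<ge> 1" "b \<ge> 1" for a b :: real
    proof -
      \<comment> \<open>Each of \<open>a\<close> and \<open>b\<close> is at most
        \<open>a + b - 1\<close>, because the other is at least 1.\<close>
      have "a * b \<le> (a + b - 1) * (a + b - 1)"
        using that by (intro mult_mono) auto
      then have "sqrt (a * b) \<le> a + b - 1"
        using that by (intro real_le_lsqrt) (auto simp: power2_eq_square)
      moreover have "x powr (- (3 / 2)) = 1 / (x * sqrt x)" if "x \<ge> 1" for x :: real
        using that powr_add[of x 1 "1 / 2"] by (simp add: powr_minus_divide powr_half_sqrt)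
      ultimately show ?thesis
        using that by (auto simp: real_sqrt_mult ac_simps intro!: divide_left_mono mult_left_mono mult_pos_pos)
    qed
    have "\<bar>f p q\<bar> \<le> g p * g q"
      using xy[of "real p + 1" "real q + 1"] assms[of p q] by (simp add: g_def algebra_simps)
    then show "norm (case x of (p, q) \<Rightarrow> f p q) \<le> norm (case x of (p, q) \<Rightarrow> g p * g q)"
      by (simp add: x)
  qed
  from Infinite_Sum.abs_summable_summable[OF this] show ?thesis
    by simp
qed

section \<open>Signed Leibniz tails and digamma differences\<close>

text \<open>This is \<beta>(N) of the overview, normalised so that its series starts with a positive
  term. Writing it as \<pi>/4 minus a finite sum makes the recurrence pure algebra and yields the
  explicit initial terms of the final formulas.\<close>

definition leibniz_tail :: "nat \<Rightarrow> real" where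
  "leibniz_tail N = (-1) ^ N * (pi / 4 - (\<Sum>q<N. (-1) ^ q / (2 * real q + 1)))"

lemma leibniz_sums: "(\<lambda>q. (-1) ^ q / (2 * real q + 1)) sums (pi / 4)"
proof -
  have "summable (\<lambda>q. (-1) ^ q * (1 / real (q * 2 + 1) * 1 ^ (q * 2 + 1)))"
    by (rule summable_arctan_series) simp
  then show ?thesis
    using pi_series by (simp add: sums_iff algebra_simps)
qed

lemma leibniz_tail_sums: "(\<lambda>j. (-1) ^ j / (2 * (real N + real j) + 1)) sums leibniz_tail N"
proof -
  have "(\<lambda>j. (-1) ^ (j + N) / (2 * real (j + N) + 1)) sums
          (pi / 4 - (\<Sum>q<N. (-1) ^ q / (2 * real q + 1)))"
    by (subst sums_iff_shift) (simp add: leibniz_sums)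
  from sums_mult[OF this, of "(-1) ^ N"]
  have "(\<lambda>j. (-1) ^ N * ((-1) ^ (j + N) / (2 * real (j + N) + 1))) sums leibniz_tail N"
    by (simp only: leibniz_tail_def)
  also have "(\<lambda>j. (-1) ^ N * ((-1) ^ (j + N) / (2 * real (j + N) + 1))) =
      (\<lambda>j. (-1) ^ j / (2 * (real N + real j) + 1))"
    by (rule ext) (simp add: power_add add.commute)
  finally show ?thesis .
qed

lemma leibniz_tail_Suc: "leibniz_tail (Suc N) = 1 / (2 * real N + 1) - leibniz_tail N"
  by (simp add: leibniz_tail_def algebra_simps flip: power_add power_mult_distrib)

text \<open>In the difference of the two digamma series, the harmonic terms and the Euler-Mascheroni
  constant cancel.\<close>

lemma Digamma_diff_half_sums:
  fixes z :: real
  assumes "z > 0"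
  shows "(\<lambda>i. 1 / (z + real i) - 1 / (z + 1 / 2 + real i)) sums (Digamma (z + 1 / 2) - Digamma z)"
proof -
  have "(\<lambda>i. inverse (real (Suc i)) - inverse (z + real i)) sums (Digamma z + euler_mascheroni)"
    if "z > 0" for z :: real
    using summable_Digamma[of z] that by (simp add: Digamma_def sums_iff)
  from sums_diff[OF this[of "z + 1 / 2"] this[of z]] assms show ?thesis
    by (simp add: inverse_eq_divide)
qed

text \<open>For \<open>z = (2N + 1)/4\<close> the terms \<open>1/(z + i)\<close> and
  \<open>1/(z + 1/2 + i)\<close> are 4 times the Leibniz terms with \<open>j = 2i\<close> and
  \<open>j = 2i + 1\<close>, up to the sign of the latter. Grouping the alternating series in pairs
  thus gives the digamma series.\<close>

lemma Digamma_diff_eq_leibniz_tail: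
  "Digamma ((2 * real N + 3) / 4) - Digamma ((2 * real N + 1) / 4) = 4 * leibniz_tail N"
proof (rule sums_unique2)
  have "(2 * real N + 1) / 4 + 1 / 2 = (2 * real N + 3) / 4" "(2 * real N + 1) / 4 > 0"
    by (simp_all add: add_nonneg_pos)
  then show "(\<lambda>i. 1 / ((2 * real N + 1) / 4 + real i) - 1 / ((2 * real N + 1) / 4 + 1 / 2 + real i)) sums
        (Digamma ((2 * real N + 3) / 4) - Digamma ((2 * real N + 1) / 4))"
    using Digamma_diff_half_sums[of "(2 * real N + 1) / 4"] by presburger
  have sums: "(\<lambda>i. 4 * sum (\<lambda>j. (-1) ^ j / (2 * (real N + real j) + 1)) {i * 2..<i * 2 + 2})
      sums (4 * leibniz_tail N)"
    by (intro sums_mult sums_group[OF leibniz_tail_sums]) simp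
  have "4 * sum (\<lambda>j. (-1) ^ j / (2 * (real N + real j) + 1)) {i * 2..<i * 2 + 2} =
      1 / ((2 * real N + 1) / 4 + real i) - 1 / ((2 * real N + 1) / 4 + 1 / 2 + real i)" for i
  proof -
    have "{i * 2..<i * 2 + 2} = {i * 2, Suc (i * 2)}" by auto
    then show ?thesis by (simp add: field_simps add_nonneg_eq_0_iff flip: power_mult)
  qed
  then show "(\<lambda>i. 1 / ((2 * real N + 1) / 4 + real i) - 1 / ((2 * real N + 1) / 4 + 1 / 2 + real i)) sums
      (4 * leibniz_tail N)"
    using sums by simp
qed

text \<open>In terms of \<open>p = k + m + 1\<close> the summand depends on \<open>d = n - m\<close>
  only; \<open>m\<close> merely decides where the series starts.\<close>

lemma Theta1_term_eq:
  "Theta1_term m (m + d) (Suc k) =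
     4 * leibniz_tail (k + Suc m + d + 1) / (2 * real (k + Suc m) + 1)\<^sup>2"
  using Digamma_diff_eq_leibniz_tail[of "k + Suc m + d + 1"]
  by (simp add: Theta1_term_def algebra_simps)

section \<open>Auxiliary single series\<close>

text \<open>Pairing consecutive terms separates odd from even bases; the even ones contribute
  \<open>S / 2 ^ k\<close>.\<close>

lemma odd_inverse_powers_sums:
  assumes z: "(\<lambda>n. 1 / (real n + 1) ^ k) sums S"
  shows "(\<lambda>p. 1 / (2 * real p + 1) ^ k) sums (S - S / 2 ^ k)"
proof -
  have "(\<lambda>n. sum (\<lambda>n. 1 / (real n + 1) ^ k) {n * 2..<n * 2 + 2}) sums S"
    by (rule sums_group[OF z]) simp
  also have "(\<lambda>n. sum (\<lambda>n. 1 / (real n + 1) ^ k) {n * 2..<n * 2 + 2}) =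
      (\<lambda>n. 1 / (2 * real n + 1) ^ k + 1 / (2 * real n + 2) ^ k)"
    by (rule ext) (simp add: numeral_2_eq_2 algebra_simps)
  finally have a: "(\<lambda>n. 1 / (2 * real n + 1) ^ k + 1 / (2 * real n + 2) ^ k) sums S" .
  have "(1 / (real n + 1) ^ k) / 2 ^ k = 1 / (2 * real n + 2) ^ k" for n
  proof -
    have "2 * real n + 2 = (real n + 1) * 2" by simp
    then show ?thesis by (simp only: power_mult_distrib) simp
  qed
  with sums_divide[OF z, of "2 ^ k"] have b: "(\<lambda>n. 1 / (2 * real n + 2) ^ k) sums (S / 2 ^ k)"
    by simp
  show ?thesis
    using sums_diff[OF a b] by simp
qed

lemma odd_inverse_squares_sums: "(\<lambda>p. 1 / (2 * real p + 1)\<^sup>2) sums (pi\<^sup>2 / 8)"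
  using odd_inverse_powers_sums[of 2 "pi\<^sup>2 / 6"] inverse_squares_sums by (simp add: add.commute)

lemma odd_inverse_cubes_sums: "(\<lambda>p. 1 / (2 * real p + 1) ^ 3) sums (7 / 8 * zeta 3)"
proof -
  have "(\<lambda>n. 1 / (real n + 1) ^ 3) sums zeta 3"
    using summable_sums[OF summable_zeta[of 3]] by (simp add: zeta_def add.commute)
  from odd_inverse_powers_sums[OF this] show ?thesis
    by simp
qed

lemma half_alternating_harmonic_sums: "(\<lambda>q. (-1) ^ q / (2 * real q + 2)) sums (ln 2 / 2)"
proof -
  have "(-1) ^ q / real (Suc q) / 2 = (-1) ^ q / (2 * real q + 2)" for q
    by (simp add: field_simps)
  with sums_divide[OF alternating_harmonic_series_sums, of 2] show ?thesis
    by (simp only:)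
qed

lemma half_alternating_harmonic_tail_sums:
  "(\<lambda>q. (-1) ^ q / (2 * real p + 2 * real q + 2)) sums
     ((-1) ^ p * (ln 2 / 2 - (\<Sum>q<p. (-1) ^ q / (2 * real q + 2))))"
proof -
  have "(\<lambda>q. (-1) ^ (q + p) / (2 * real (q + p) + 2)) sums
          (ln 2 / 2 - (\<Sum>q<p. (-1) ^ q / (2 * real q + 2)))"
    by (subst sums_iff_shift) (simp add: half_alternating_harmonic_sums)
  from sums_mult[OF this, of "(-1) ^ p"]
  show ?thesis
    by (rule sums_cong[THEN iffD1, rotated]) (simp add: power_add algebra_simps)
qed

text \<open>Telescoping with step \<open>e\<close>, reduced by induction to step 1: each increase of
  \<open>e\<close> adds one ordinary telescoping series.\<close>

lemma odd_shifted_difference_sums: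
  "(\<lambda>p. 1 / (2 * real p + 1) - 1 / (2 * real p + 2 * real e + 1)) sums (\<Sum>i<e. 1 / (2 * real i + 1))"
proof (induction e)
  case (Suc e)
  have "(\<lambda>p. 1 / (2 * real (p + e) + 1)) \<longlonglongrightarrow> 0"
    by (rule LIMSEQ_ignore_initial_segment) real_asymp
  from telescope_sums'[OF this]
  have "(\<lambda>p. 1 / (2 * real p + 2 * real e + 1) - 1 / (2 * real p + 2 * real (Suc e) + 1)) sums
      (1 / (2 * real e + 1))"
    by (simp add: algebra_simps)
  from sums_add[OF Suc.IH this] show ?case
    by simp
qed simp

lemma catalan_G_sums: "(\<lambda>p. (-1) ^ p / (2 * real p + 1)\<^sup>2) sums catalan_G"
  using summable_catalan_G by (simp add: catalan_G_def summable_sums)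

section \<open>Evaluation of T through the double sums W and Y\<close>

lemma leibniz_tail_squares_sums:
  "(\<lambda>p. leibniz_tail (p + 1) / (2 * real p + 1)\<^sup>2) sums
     ((- pi * catalan_G + pi\<^sup>2 / 4 * ln 2 + 7 / 4 * zeta 3) / 4)"
proof -
  define s where "s p = (\<Sum>q<p. (-1) ^ q / (2 * real q + 1))" for p :: nat
  define l where "l p = (\<Sum>q<p. (-1) ^ q / (2 * real q + 2))" for p :: nat
  define h where "h p = (\<Sum>q<p. 1 / (2 * real q + 1))" for p :: nat
  define f :: "nat \<Rightarrow> nat \<Rightarrow> real" where
    "f p q = (-1) ^ q / ((2 * real p + 1) * (2 * real q + 2) * (2 * real p + 2 * real q + 3))" for p q
  define g :: "nat \<Rightarrow> nat \<Rightarrow> real" where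
    "g p q = (-1) ^ (p + q) / ((2 * real p + 1) * (2 * real q + 1) * (2 * real p + 2 * real q + 2))" for p q
  \<comment> \<open>Factor by factor, the denominator dominates \<open>p + 1\<close>,
    \<open>q + 1\<close> and \<open>p + q + 1\<close>.\<close>
  have "\<bar>f p q\<bar> \<le> 1 / ((real p + 1) * (real q + 1) * (real p + real q + 1))" for p q
    unfolding f_def abs_divide power_abs by (auto intro!: divide_left_mono mult_mono simp: abs_mult)
  from summable_on_inverse_product_sum[of f, OF this] obtain W where
    W_row: "\<And>r. (\<And>p. f p sums r p) \<Longrightarrow> r sums W" and
    W_col: "\<And>c. (\<And>q. (\<lambda>p. f p q) sums c q) \<Longrightarrow> c sums W" and
    W_diag: "(\<lambda>n. \<Sum>p\<le>n. f p (n - p)) sums W"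
    by (rule double_sums) blast
  have "\<bar>g p q\<bar> \<le> 1 / ((real p + 1) * (real q + 1) * (real p + real q + 1))" for p q
    unfolding g_def abs_divide power_abs by (auto intro!: divide_left_mono mult_mono simp: abs_mult)
  from summable_on_inverse_product_sum[of g, OF this] obtain Y where
    Y_row: "\<And>r. (\<And>p. g p sums r p) \<Longrightarrow> r sums Y" and
    Y_diag: "(\<lambda>n. \<Sum>p\<le>n. g p (n - p)) sums Y"
    by (rule double_sums) blast
  \<comment> \<open>Rows of \<open>W\<close>: \<open>1/(ab(a + b)) = (1/b - 1/(a + b))/a^2\<close>.
    The first part sums to \<open>ln 2 / 2\<close>; as \<open>a + b\<close> is odd, the second is a
    Leibniz tail.\<close>
  have row: "(\<lambda>p. (ln 2 / 2 - leibniz_tail (p + 1)) / (2 * real p + 1)\<^sup>2) sums W"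
  proof (rule W_row)
    fix p
    have "(\<lambda>q. ((-1) ^ q / (2 * real q + 2) - (-1) ^ q / (2 * (real (p + 1) + real q) + 1)) / (2 * real p + 1)\<^sup>2)
        sums ((ln 2 / 2 - leibniz_tail (p + 1)) / (2 * real p + 1)\<^sup>2)"
      by (intro sums_divide sums_diff half_alternating_harmonic_sums leibniz_tail_sums)
    also have "(\<lambda>q. ((-1) ^ q / (2 * real q + 2) - (-1) ^ q / (2 * (real (p + 1) + real q) + 1)) / (2 * real p + 1)\<^sup>2) = f p"
    proof
      fix q
      have "x / b - x / (a + b) = x * a / (b * (a + b))" if "a > 0" "b > 0" for x a b :: real
        using that by (simp add: field_simps)
      from this[of "2 * real p + 1" "2 * real q + 2" "(-1) ^ q"]
      show "((-1) ^ q / (2 * real q + 2) - (-1) ^ q / (2 * (real (p + 1) + real q) + 1)) / (2 * real p + 1)\<^sup>2 = f p q"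
        by (simp add: f_def power2_eq_square add_ac mult_ac)
    qed
    finally show "f p sums ((ln 2 / 2 - leibniz_tail (p + 1)) / (2 * real p + 1)\<^sup>2)" .
  qed
  \<comment> \<open>Columns of \<open>W\<close>:
    \<open>1/(ab(a + b)) = (1/a - 1/(a + b))/b^2\<close>. As \<open>b\<close> is even, the shift
    stays among the odd numbers and the difference telescopes to a finite sum.\<close>
  have col: "(\<lambda>q. (-1) ^ q * h (q + 1) / (2 * real q + 2)\<^sup>2) sums W"
  proof (rule W_col)
    fix q
    have "(\<lambda>p. (-1) ^ q / (2 * real q + 2)\<^sup>2 * (1 / (2 * real p + 1) - 1 / (2 * real p + 2 * real (q + 1) + 1)))
        sums ((-1) ^ q / (2 * real q + 2)\<^sup>2 * h (q + 1))"
      unfolding h_def by (intro sums_mult odd_shifted_difference_sums)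
    also have "(\<lambda>p. (-1) ^ q / (2 * real q + 2)\<^sup>2 * (1 / (2 * real p + 1) - 1 / (2 * real p + 2 * real (q + 1) + 1)))
        = (\<lambda>p. f p q)"
    proof
      fix p
      have "x / b\<^sup>2 * (1 / a - 1 / (a + b)) = x / (a * b * (a + b))" if "a > 0" "b > 0" for x a b :: real
        using that by (simp add: divide_simps power2_eq_square)
      from this[of "2 * real p + 1" "2 * real q + 2" "(-1) ^ q"]
      show "(-1) ^ q / (2 * real q + 2)\<^sup>2 * (1 / (2 * real p + 1) - 1 / (2 * real p + 2 * real (q + 1) + 1)) = f p q"
        by (simp add: f_def add_ac)
    qed
    finally show "(\<lambda>p. f p q) sums ((-1) ^ q * h (q + 1) / (2 * real q + 2)\<^sup>2)"
      by simp
  qed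
  \<comment> \<open>Diagonals of \<open>W\<close>: \<open>1/(ab) = (1/a + 1/b)/(a + b)\<close>,
    where \<open>a + b = 2n + 3\<close> is constant on the diagonal.\<close>
  have diag: "(\<lambda>p. (l p - (-1) ^ p * s p) / (2 * real p + 1)\<^sup>2) sums W"
  proof -
    have "(\<Sum>p\<le>n. f p (n - p)) = (l (Suc n) - (-1) ^ Suc n * s (Suc n)) / (2 * real (Suc n) + 1)\<^sup>2" for n
    proof -
      have "f p (n - p) = ((-1) ^ (n - p) / (2 * real (n - p) + 2) + (-1) ^ n * ((-1) ^ p / (2 * real p + 1)))
          / (2 * real (Suc n) + 1)\<^sup>2" if "p \<le> n" for p
      proof -
        have "x / (a * b * z) = (x / b + x / a) / z\<^sup>2" if "a > 0" "b > 0" "z = a + b" for x a b z :: real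
          using that by (simp add: divide_simps power2_eq_square) (simp add: algebra_simps)
        from this[of "2 * real p + 1" "2 * real (n - p) + 2" "2 * real p + 2 * real (n - p) + 3" "(-1) ^ (n - p)"]
        have "f p (n - p) = ((-1) ^ (n - p) / (2 * real (n - p) + 2) + (-1) ^ (n - p) / (2 * real p + 1))
            / (2 * real p + 2 * real (n - p) + 3)\<^sup>2"
          by (simp add: f_def)
        moreover have "(-1) ^ (n - p) / (2 * real p + 1) = (-1) ^ n * ((-1) ^ p / (2 * real p + 1))"
          using that by (simp add: minus_one_power_iff)
        moreover have "2 * real p + 2 * real (n - p) + 3 = 2 * real (Suc n) + 1"
          using that by simp
        ultimately show ?thesis
          by simp
      qed
      then have "(\<Sum>p\<le>n. f p (n - p)) =
          (\<Sum>p\<le>n. ((-1) ^ (n - p) / (2 * real (n - p) + 2) + (-1) ^ n * ((-1) ^ p / (2 * real p + 1)))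
          / (2 * real (Suc n) + 1)\<^sup>2)"
        by (intro sum.cong) auto
      also have "\<dots> = ((\<Sum>p\<le>n. (-1) ^ (n - p) / (2 * real (n - p) + 2)) +
          (-1) ^ n * (\<Sum>p\<le>n. (-1) ^ p / (2 * real p + 1))) / (2 * real (Suc n) + 1)\<^sup>2"
        by (simp only: sum_divide_distrib[symmetric] sum.distrib sum_distrib_left[symmetric])
      also have "(\<Sum>p\<le>n. (-1) ^ (n - p) / (2 * real (n - p) + 2)) = l (Suc n)"
        using sum.nat_diff_reindex[of "\<lambda>q. (-1) ^ q / (2 * real q + 2)" "Suc n"]
        by (simp only: l_def lessThan_Suc_atMost diff_Suc_Suc)
      finally show ?thesis
        by (simp add: s_def lessThan_Suc_atMost)
    qed
    with W_diag have "(\<lambda>n. (l (Suc n) - (-1) ^ Suc n * s (Suc n)) / (2 * real (Suc n) + 1)\<^sup>2) sums W"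
      by simp
    \<comment> \<open>Diagonal \<open>n\<close> carries the index \<open>Suc n\<close>; the missing
      term at 0 vanishes because \<open>l 0 = s 0 = 0\<close>.\<close>
    then show ?thesis
      by (subst (asm) sums_Suc_iff) (simp add: l_def s_def)
  qed
  \<comment> \<open>Rows of \<open>Y\<close>: now \<open>a + b\<close> is even, so the roles change:
    the full series is Leibniz and the tail is that of \<open>ln 2 / 2\<close>.\<close>
  have "(\<lambda>p. ((-1) ^ p * pi / 4 - ln 2 / 2 + l p) / (2 * real p + 1)\<^sup>2) sums Y"
  proof (rule Y_row)
    fix p
    have "(\<lambda>q. (-1) ^ p / (2 * real p + 1)\<^sup>2 *
          ((-1) ^ q / (2 * real q + 1) - (-1) ^ q / (2 * real p + 2 * real q + 2)))
        sums ((-1) ^ p / (2 * real p + 1)\<^sup>2 * (pi / 4 - (-1) ^ p * (ln 2 / 2 - l p)))"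
      unfolding l_def
      by (intro sums_mult sums_diff leibniz_sums half_alternating_harmonic_tail_sums)
    moreover have "(\<lambda>q. (-1) ^ p / (2 * real p + 1)\<^sup>2 *
          ((-1) ^ q / (2 * real q + 1) - (-1) ^ q / (2 * real p + 2 * real q + 2))) = g p"
    proof
      fix q
      have "y / a\<^sup>2 * (x / b - x / z) = y * x / (a * b * z)" if "a > 0" "b > 0" "z = a + b" for x y z a b :: real
        using that by (simp add: divide_simps power2_eq_square) (simp add: algebra_simps)
      from this[of "2 * real p + 1" "2 * real q + 1" "2 * real p + 2 * real q + 2" "(-1) ^ p" "(-1) ^ q"]
      show "(-1) ^ p / (2 * real p + 1)\<^sup>2 *
          ((-1) ^ q / (2 * real q + 1) - (-1) ^ q / (2 * real p + 2 * real q + 2)) = g p q"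
        by (simp add: g_def power_add)
    qed
    moreover have "(-1) ^ p / (2 * real p + 1)\<^sup>2 * (pi / 4 - (-1) ^ p * (ln 2 / 2 - l p)) =
        ((-1) ^ p * pi / 4 - ln 2 / 2 + l p) / (2 * real p + 1)\<^sup>2"
      by (cases "even p") (simp_all add: add_divide_distrib diff_divide_distrib)
    ultimately show "g p sums (((-1) ^ p * pi / 4 - ln 2 / 2 + l p) / (2 * real p + 1)\<^sup>2)"
      by simp
  qed
  \<comment> \<open>On a diagonal of \<open>Y\<close> the sign and \<open>a + b = 2n + 2\<close> are
    constant, and \<open>1/a\<close> and \<open>1/b\<close> have equal sums by symmetry. The result
    is twice the \<open>n\<close>-th column sum of \<open>W\<close>.\<close>
  moreover have "Y = 2 * W"
  proof (rule sums_unique2[OF Y_diag])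
    have "(\<Sum>p\<le>n. g p (n - p)) = 2 * ((-1) ^ n * h (n + 1) / (2 * real n + 2)\<^sup>2)" for n
    proof -
      have "g p (n - p) = (-1) ^ n / (2 * real n + 2)\<^sup>2 * (1 / (2 * real p + 1) + 1 / (2 * real (n - p) + 1))"
        if "p \<le> n" for p
      proof -
        have "x / (a * b * z) = x / z\<^sup>2 * (1 / a + 1 / b)" if "a > 0" "b > 0" "z = a + b" for x a b z :: real
          using that by (simp add: divide_simps power2_eq_square)
        from this[of "2 * real p + 1" "2 * real (n - p) + 1" "2 * real p + 2 * real (n - p) + 2" "(-1) ^ n"]
        show ?thesis
          using that by (simp add: g_def of_nat_diff)
      qed
      then have "(\<Sum>p\<le>n. g p (n - p)) =
          (\<Sum>p\<le>n. (-1) ^ n / (2 * real n + 2)\<^sup>2 * (1 / (2 * real p + 1) + 1 / (2 * real (n - p) + 1)))"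
        by (intro sum.cong) auto
      also have "\<dots> = (-1) ^ n / (2 * real n + 2)\<^sup>2 *
          ((\<Sum>p\<le>n. 1 / (2 * real p + 1)) + (\<Sum>p\<le>n. 1 / (2 * real (n - p) + 1)))"
        by (simp only: sum_distrib_left[symmetric] sum.distrib)
      also have "(\<Sum>p\<le>n. 1 / (2 * real (n - p) + 1)) = h (Suc n)"
        using sum.nat_diff_reindex[of "\<lambda>q. 1 / (2 * real q + 1)" "Suc n"]
        by (simp only: h_def lessThan_Suc_atMost diff_Suc_Suc)
      finally show ?thesis
        by (simp add: h_def lessThan_Suc_atMost)
    qed
    then show "(\<lambda>n. \<Sum>p\<le>n. g p (n - p)) sums (2 * W)"
      using sums_mult[OF col, of 2] by simp
  qed
  ultimately have Y: "(\<lambda>p. ((-1) ^ p * pi / 4 - ln 2 / 2 + l p) / (2 * real p + 1)\<^sup>2) sums (2 * W)"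
    by simp
  \<comment> \<open>This expresses the partial sum \<open>s p\<close> through a tail, so that the
    diagonal form of \<open>W\<close> can be used to eliminate \<open>l p\<close> from the rows of
    \<open>Y\<close>.\<close>
  have split: "leibniz_tail (p + 1) = 1 / (2 * real p + 1) - (-1) ^ p * (pi / 4) + (-1) ^ p * s p" for p
    using leibniz_tail_Suc[of p] by (simp add: leibniz_tail_def[of p] s_def algebra_simps)
  define L where "L = ln 2 / 2 * (pi\<^sup>2 / 8)"
  have L: "(\<lambda>p. ln 2 / 2 * (1 / (2 * real p + 1)\<^sup>2)) sums L"
    unfolding L_def by (intro sums_mult odd_inverse_squares_sums)
  have G: "(\<lambda>p. pi / 4 * ((-1) ^ p / (2 * real p + 1)\<^sup>2)) sums (pi / 4 * catalan_G)"
    by (intro sums_mult catalan_G_sums)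
  have T: "(\<lambda>p. leibniz_tail (p + 1) / (2 * real p + 1)\<^sup>2) sums (L - W)"
    using sums_diff[OF L row] by (simp add: diff_divide_distrib)
  \<comment> \<open>Here \<open>L - W\<close> is T. On the right both \<open>L\<close> and
    \<open>W\<close> cancel, which leaves
    \<open>2 * W = pi / 2 * catalan_G - 7 / 8 * zeta 3\<close>.\<close>
  have "2 * W = pi / 4 * catalan_G - L + W + ((L - W) - 7 / 8 * zeta 3 + pi / 4 * catalan_G)"
  proof (rule sums_unique2[OF Y])
    have "(\<lambda>p. pi / 4 * ((-1) ^ p / (2 * real p + 1)\<^sup>2) - ln 2 / 2 * (1 / (2 * real p + 1)\<^sup>2)
         + (l p - (-1) ^ p * s p) / (2 * real p + 1)\<^sup>2
         + (leibniz_tail (p + 1) / (2 * real p + 1)\<^sup>2 - 1 / (2 * real p + 1) ^ 3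
            + pi / 4 * ((-1) ^ p / (2 * real p + 1)\<^sup>2))) sums
       (pi / 4 * catalan_G - L + W + ((L - W) - 7 / 8 * zeta 3 + pi / 4 * catalan_G))"
      by (intro sums_add sums_diff G L diag T odd_inverse_cubes_sums)
    moreover have "pi / 4 * ((-1) ^ p / (2 * real p + 1)\<^sup>2) - ln 2 / 2 * (1 / (2 * real p + 1)\<^sup>2)
         + (l p - (-1) ^ p * s p) / (2 * real p + 1)\<^sup>2
         + (leibniz_tail (p + 1) / (2 * real p + 1)\<^sup>2 - 1 / (2 * real p + 1) ^ 3
            + pi / 4 * ((-1) ^ p / (2 * real p + 1)\<^sup>2)) =
        ((-1) ^ p * pi / 4 - ln 2 / 2 + l p) / (2 * real p + 1)\<^sup>2" for p
      unfolding split
      by (simp add: add_divide_distrib diff_divide_distrib power2_eq_square power3_eq_cube)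
    ultimately show "(\<lambda>p. ((-1) ^ p * pi / 4 - ln 2 / 2 + l p) / (2 * real p + 1)\<^sup>2) sums
        (pi / 4 * catalan_G - L + W + ((L - W) - 7 / 8 * zeta 3 + pi / 4 * catalan_G))"
      by simp
  qed
  then have "L - W = (- pi * catalan_G + pi\<^sup>2 / 4 * ln 2 + 7 / 4 * zeta 3) / 4"
    by (simp add: L_def algebra_simps)
  with T show ?thesis
    by simp
qed

section \<open>Recurrence in the offset d and its closed forms\<close>

text \<open>The recurrence for \<beta> flips the sign of the old series and adds the sum of
  \<open>4/(a^2(a + 2e))\<close> with \<open>a = 2p + 1\<close>, \<open>e = d + 1\<close>. The
  latter equals \<open>2/(e a^2) - (1/a - 1/(a + 2e))/e^2\<close>: odd inverse squares and a
  telescoping series.\<close>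

lemma leibniz_tail_squares_shift:
  assumes "(\<lambda>p. 4 * leibniz_tail (p + d + 1) / (2 * real p + 1)\<^sup>2) sums v"
  shows "(\<lambda>p. 4 * leibniz_tail (p + Suc d + 1) / (2 * real p + 1)\<^sup>2) sums
    (pi\<^sup>2 / 4 / real (Suc d) - (\<Sum>i<Suc d. 1 / (2 * real i + 1)) / (real (Suc d))\<^sup>2 - v)"
proof -
  define e where "e = real (Suc d)"
  have e: "e > 0" by (simp add: e_def)
  have "(\<lambda>p. 2 / e * (1 / (2 * real p + 1)\<^sup>2)
        - (1 / (2 * real p + 1) - 1 / (2 * real p + 2 * real (Suc d) + 1)) / e\<^sup>2
        - 4 * leibniz_tail (p + d + 1) / (2 * real p + 1)\<^sup>2) sums
      (2 / e * (pi\<^sup>2 / 8) - (\<Sum>i<Suc d. 1 / (2 * real i + 1)) / e\<^sup>2 - v)"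
    by (intro sums_diff sums_mult sums_divide odd_inverse_squares_sums odd_shifted_difference_sums assms)
  moreover have "2 / e * (1 / (2 * real p + 1)\<^sup>2)
        - (1 / (2 * real p + 1) - 1 / (2 * real p + 2 * real (Suc d) + 1)) / e\<^sup>2
        - 4 * leibniz_tail (p + d + 1) / (2 * real p + 1)\<^sup>2
      = 4 * leibniz_tail (p + Suc d + 1) / (2 * real p + 1)\<^sup>2" for p
  proof -
    have "2 / e * (1 / a\<^sup>2) - (1 / a - 1 / z) / e\<^sup>2 = 4 * (1 / z) / a\<^sup>2"
      if "a > 0" "z = a + 2 * e" for a z :: real
    proof -
      have "a \<noteq> 0" "e \<noteq> 0" "z \<noteq> 0" using that e by auto
      then show ?thesis
        using that(2) by (simp add: divide_simps power2_eq_square)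
    qed
    from this[of "2 * real p + 1" "2 * real p + 2 * real (Suc d) + 1"]
    have "2 / e * (1 / (2 * real p + 1)\<^sup>2)
        - (1 / (2 * real p + 1) - 1 / (2 * real p + 2 * real (Suc d) + 1)) / e\<^sup>2
      = 4 * (1 / (2 * real p + 2 * real (Suc d) + 1)) / (2 * real p + 1)\<^sup>2"
      by (simp add: e_def)
    moreover have "leibniz_tail (p + Suc d + 1) =
        1 / (2 * real p + 2 * real (Suc d) + 1) - leibniz_tail (p + d + 1)"
      using leibniz_tail_Suc[of "p + d + 1"] by (simp add: algebra_simps)
    ultimately show ?thesis
      by (simp only: right_diff_distrib diff_divide_distrib)
  qed
  moreover have "2 / e * (pi\<^sup>2 / 8) = pi\<^sup>2 / 4 / e"
    by simp
  ultimately show ?thesis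
    by (simp only: e_def)
qed

text \<open>Removing the even denominators below \<open>4 * j\<close> from
  \<open>harm (4 * j - 1)\<close> removes \<open>harm (2 * j - 1) / 2\<close>. This turns the odd
  sums produced by the recurrence into harmonic numbers.\<close>

lemma sum_odd_inverses_eq_harm:
  assumes "j > 0"
  shows "(\<Sum>i<2 * j. 1 / (2 * real i + 1)) = harm (4 * j - 1) - harm (2 * j - 1) / 2"
proof -
  have "(\<Sum>q<2 * i + 2. 1 / (2 * real q + 1)) = harm (4 * i + 3) - harm (2 * i + 1) / 2" for i
  proof (induction i)
    case 0
    show ?case
      by (simp add: harm_Suc harm_expand(1) eval_nat_numeral)
  next
    case (Suc i)
    have eqs: "4 * Suc i + 3 = Suc (Suc (Suc (Suc (4 * i + 3))))" "2 * Suc i + 1 = Suc (Suc (2 * i + 1))"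
      "2 * Suc i + 2 = Suc (Suc (2 * i + 2))"
      by simp_all
    have s1: "(\<Sum>q<2 * Suc i + 2. 1 / (2 * real q + 1)) =
        (\<Sum>q<2 * i + 2. 1 / (2 * real q + 1)) + 1 / (4 * real i + 5) + 1 / (4 * real i + 7)"
      unfolding eqs sum.lessThan_Suc by (simp add: add_ac)
    have s2: "harm (4 * Suc i + 3) = harm (4 * i + 3) + 1 / (4 * real i + 4) + 1 / (4 * real i + 5)
        + 1 / (4 * real i + 6) + 1 / (4 * real i + 7)"
      unfolding eqs harm_Suc by (simp add: inverse_eq_divide add_ac)
    have s3: "harm (2 * Suc i + 1) = harm (2 * i + 1) + 1 / (2 * real i + 2) + 1 / (2 * real i + 3)"
      unfolding eqs harm_Suc by (simp add: inverse_eq_divide add_ac)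
    have s4: "1 / (2 * real i + 2) / 2 = 1 / (4 * real i + 4)" "1 / (2 * real i + 3) / 2 = 1 / (4 * real i + 6)"
      by (simp_all add: algebra_simps)
    show ?case
      unfolding s1 s2 s3 Suc.IH add_divide_distrib s4 by simp
  qed
  from this[of "j - 1"] assms show ?thesis
    by (cases j) (simp_all add: add_ac)
qed

text \<open>The value 4T at offset 0. Every unit shift of the offset reverses its sign.\<close>

definition Theta1_const :: real where
  "Theta1_const = - pi * catalan_G + pi\<^sup>2 / 4 * ln 2 + 7 / 4 * zeta 3"

lemma leibniz_tail_squares_sums_0:
  "(\<lambda>p. 4 * leibniz_tail (p + 0 + 1) / (2 * real p + 1)\<^sup>2) sums Theta1_const"
proof -
  have "4 * (Theta1_const / 4) = Theta1_const"
    by simp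
  with sums_mult[OF leibniz_tail_squares_sums[folded Theta1_const_def], of 4] show ?thesis
    by simp
qed

text \<open>Starting from offset 1, each induction step applies the recurrence twice, with
  \<open>e = 2j\<close> and then \<open>e = 2j + 1\<close> for \<open>j = L + 1\<close>; the two
  sign changes cancel.\<close>

lemma leibniz_tail_squares_sums_odd:
  "(\<lambda>p. 4 * leibniz_tail (p + (2 * L + 1) + 1) / (2 * real p + 1)\<^sup>2) sums
    (- 1 - 1 / 8 * (\<Sum>j=1..L. (4 * real j + 1) * (harm (2 * j - 1) - 2 * harm (4 * j - 1))
                  / ((real j)\<^sup>2 * (2 * real j + 1)\<^sup>2))
      - (\<Sum>j=1..L. 1 / ((2 * real j + 1)\<^sup>2 * (4 * real j + 1)))
      + pi\<^sup>2 / 4 * (1 - 1 / 2 * (\<Sum>j=1..L. 1 / (real j * (2 * real j + 1))))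
      - Theta1_const)"
proof (induction L)
  case 0
  from leibniz_tail_squares_shift[OF leibniz_tail_squares_sums_0] show ?case
    by simp
next
  case (Suc L)
  define j where "j = Suc L"
  have j: "real j > 0" "j > 0" by (simp_all add: j_def)
  define u where "u = (\<Sum>i<2 * j. 1 / (2 * real i + 1))"
  have u: "harm (2 * j - 1) - 2 * harm (4 * j - 1) = - 2 * u"
    using sum_odd_inverses_eq_harm[OF j(2)] by (simp add: u_def)
  have idx: "Suc (Suc (2 * L + 1)) = 2 * Suc L + 1" "Suc (2 * L + 1) = 2 * j" "Suc (2 * j) = 2 * j + 1"
    by (simp_all add: j_def)
  \<comment> \<open>The two shifts combined, for an arbitrary old value \<open>v\<close>. The terms
    in \<pi>, in \<open>u\<close> and the rational remainder are matched separately;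
    \<open>-2 * u\<close> stands for the harmonic numbers.\<close>
  have part: "pi\<^sup>2 / 4 / real (2 * j + 1) - (u + 1 / (2 * real (2 * j) + 1)) / (real (2 * j + 1))\<^sup>2
      - (pi\<^sup>2 / 4 / real (2 * j) - u / (real (2 * j))\<^sup>2 - v)
    = v - 1 / 8 * ((4 * real j + 1) * (- 2 * u) / ((real j)\<^sup>2 * (2 * real j + 1)\<^sup>2))
      - 1 / ((2 * real j + 1)\<^sup>2 * (4 * real j + 1)) - pi\<^sup>2 / 4 * (1 / 2 * (1 / (real j * (2 * real j + 1))))" for v
  proof -
    define x where "x = real j"
    have nz: "x \<noteq> 0" "2 * x + 1 \<noteq> 0" "4 * x + 1 \<noteq> 0"
      using j by (simp_all add: x_def)
    have "c / (2 * x + 1) - (u + 1 / (4 * x + 1)) / (2 * x + 1)\<^sup>2 - (c / (2 * x) - u / (2 * x)\<^sup>2 - v)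
      = v - 1 / 8 * ((4 * x + 1) * (- 2 * u) / (x\<^sup>2 * (2 * x + 1)\<^sup>2))
      - 1 / ((2 * x + 1)\<^sup>2 * (4 * x + 1)) - c * (1 / 2 * (1 / (x * (2 * x + 1))))" for c
    proof -
      have "c / (2 * x + 1) - c / (2 * x) = - (c * (1 / 2 * (1 / (x * (2 * x + 1)))))"
        using nz by (simp add: divide_simps) (simp add: algebra_simps)
      moreover have "u / (2 * x)\<^sup>2 - u / (2 * x + 1)\<^sup>2 =
          - (1 / 8 * ((4 * x + 1) * (- 2 * u) / (x\<^sup>2 * (2 * x + 1)\<^sup>2)))"
        using nz by (simp add: divide_simps power2_eq_square) (simp add: algebra_simps)
      moreover have "1 / (4 * x + 1) / (2 * x + 1)\<^sup>2 = 1 / ((2 * x + 1)\<^sup>2 * (4 * x + 1))"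
        by simp
      ultimately show ?thesis
        unfolding add_divide_distrib by linarith
    qed
    from this[of "pi\<^sup>2 / 4"] show ?thesis
      by (simp add: x_def add_ac)
  qed
  have sum: "(\<Sum>i<2 * j + 1. 1 / (2 * real i + 1)) = u + 1 / (2 * real (2 * j) + 1)"
    by (simp add: u_def)
  have sumj: "(\<Sum>i=1..j. F i) = (\<Sum>i=1..L. F i) + F j" for F :: "nat \<Rightarrow> real"
    by (simp add: j_def)
  have eq: "- 1 - 1 / 8 * (a + t) - (b + s) + q * (1 - 1 / 2 * (c + r)) - K =
      - 1 - 1 / 8 * a - b + q * (1 - 1 / 2 * c) - K - 1 / 8 * t - s - q * (1 / 2 * r)"
    for a b c t s r q K :: real
    by (simp add: algebra_simps add_divide_distrib)
  from leibniz_tail_squares_shift[OF leibniz_tail_squares_shift[OF Suc.IH]]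
  show ?case
    unfolding idx sum u_def[symmetric] part j_def[symmetric] sumj u eq .
qed

text \<open>The same double shift, with \<open>e = 2j + 1\<close> and then
  \<open>e = 2j + 2\<close>. The base offset 2 gives \<open>2/3 = 1 - (1 + 1/3)/4\<close>.\<close>

lemma leibniz_tail_squares_sums_even:
  "(\<lambda>p. 4 * leibniz_tail (p + (2 * L + 2) + 1) / (2 * real p + 1)\<^sup>2) sums
    (2 / 3 - 1 / 8 * (\<Sum>j=1..L. (4 * real j + 3) * (harm (2 * j - 1) - 2 * harm (4 * j - 1))
                  / ((real j + 1)\<^sup>2 * (2 * real j + 1)\<^sup>2))
      - (\<Sum>j=1..L. (4 * (real j) ^ 3 + (real j)\<^sup>2 - 4 * real j - 2)
                  / ((real j + 1)\<^sup>2 * (2 * real j + 1)\<^sup>2 * (4 * real j + 3) * (4 * real j + 1)))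
      - pi\<^sup>2 / 8 - pi\<^sup>2 / 8 * (\<Sum>j=1..L. 1 / ((real j + 1) * (2 * real j + 1)))
      + Theta1_const)"
proof (induction L)
  case 0
  from leibniz_tail_squares_shift[OF leibniz_tail_squares_shift[OF leibniz_tail_squares_sums_0]]
  show ?case
    by (simp add: numeral_2_eq_2 lessThan_Suc algebra_simps)
next
  case (Suc L)
  define j where "j = Suc L"
  have j: "real j > 0" "j > 0" by (simp_all add: j_def)
  define u where "u = (\<Sum>i<2 * j. 1 / (2 * real i + 1))"
  have u: "harm (2 * j - 1) - 2 * harm (4 * j - 1) = - 2 * u"
    using sum_odd_inverses_eq_harm[OF j(2)] by (simp add: u_def)
  have idx: "Suc (Suc (2 * L + 2)) = 2 * Suc L + 2" "Suc (2 * L + 2) = 2 * j + 1" "Suc (2 * j + 1) = 2 * j + 2"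
    by (simp_all add: j_def)
  have part: "pi\<^sup>2 / 4 / real (2 * j + 2)
      - (u + 1 / (2 * real (2 * j) + 1) + 1 / (2 * real (2 * j + 1) + 1)) / (real (2 * j + 2))\<^sup>2
      - (pi\<^sup>2 / 4 / real (2 * j + 1) - (u + 1 / (2 * real (2 * j) + 1)) / (real (2 * j + 1))\<^sup>2 - v)
    = v - 1 / 8 * ((4 * real j + 3) * (- 2 * u) / ((real j + 1)\<^sup>2 * (2 * real j + 1)\<^sup>2))
      - (4 * (real j) ^ 3 + (real j)\<^sup>2 - 4 * real j - 2)
          / ((real j + 1)\<^sup>2 * (2 * real j + 1)\<^sup>2 * (4 * real j + 3) * (4 * real j + 1))
      - pi\<^sup>2 / 8 * (1 / ((real j + 1) * (2 * real j + 1)))" for v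
  proof -
    define x where "x = real j"
    have nz: "x + 1 \<noteq> 0" "2 * x + 1 \<noteq> 0" "4 * x + 1 \<noteq> 0" "4 * x + 3 \<noteq> 0" "2 * x + 2 \<noteq> 0"
      using j by (simp_all add: x_def)
    have "c / 4 / (2 * x + 2) - (u + 1 / (4 * x + 1) + 1 / (4 * x + 3)) / (2 * x + 2)\<^sup>2
        - (c / 4 / (2 * x + 1) - (u + 1 / (4 * x + 1)) / (2 * x + 1)\<^sup>2 - v)
      = v - 1 / 8 * ((4 * x + 3) * (- 2 * u) / ((x + 1)\<^sup>2 * (2 * x + 1)\<^sup>2))
      - (4 * x ^ 3 + x\<^sup>2 - 4 * x - 2) / ((x + 1)\<^sup>2 * (2 * x + 1)\<^sup>2 * (4 * x + 3) * (4 * x + 1))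
      - c / 8 * (1 / ((x + 1) * (2 * x + 1)))" for c
    proof -
      have "c / 4 / (2 * x + 2) - c / 4 / (2 * x + 1) = - (c / 8 * (1 / ((x + 1) * (2 * x + 1))))"
        using nz by (simp add: divide_simps) (simp add: algebra_simps)
      moreover have "u / (2 * x + 1)\<^sup>2 - u / (2 * x + 2)\<^sup>2 =
          - (1 / 8 * ((4 * x + 3) * (- 2 * u) / ((x + 1)\<^sup>2 * (2 * x + 1)\<^sup>2)))"
        using nz by (simp add: divide_simps power2_eq_square) (simp add: algebra_simps)
      \<comment> \<open>The odd sums exceed \<open>u\<close> by \<open>1/(4x + 1)\<close> and, in
        the second shift, also by \<open>1/(4x + 3)\<close>. The cubic numerator arises as
        \<open>(2x + 1)^3 - (4x + 3)(x + 1)^2\<close>.\<close>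
      moreover have "1 / (4 * x + 1) / (2 * x + 1)\<^sup>2 - 1 / (4 * x + 1) / (2 * x + 2)\<^sup>2
          - 1 / (4 * x + 3) / (2 * x + 2)\<^sup>2
        = - ((4 * x ^ 3 + x\<^sup>2 - 4 * x - 2) / ((x + 1)\<^sup>2 * (2 * x + 1)\<^sup>2 * (4 * x + 3) * (4 * x + 1)))"
      proof -
        have "(2 * x + 2)\<^sup>2 = 4 * (x + 1)\<^sup>2"
          by (simp add: power2_eq_square algebra_simps)
        then show ?thesis
          using nz by (simp add: divide_simps) (simp add: power2_eq_square power3_eq_cube algebra_simps)
      qed
      ultimately show ?thesis
        unfolding add_divide_distrib by linarith
    qed
    from this[of "pi\<^sup>2"] show ?thesis
      by (simp add: x_def add_ac)
  qed
  have sum: "(\<Sum>i<2 * j + 1. 1 / (2 * real i + 1)) = u + 1 / (2 * real (2 * j) + 1)"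
    "(\<Sum>i<2 * j + 2. 1 / (2 * real i + 1)) = u + 1 / (2 * real (2 * j) + 1) + 1 / (2 * real (2 * j + 1) + 1)"
    by (simp_all add: u_def)
  have sumj: "(\<Sum>i=1..j. F i) = (\<Sum>i=1..L. F i) + F j" for F :: "nat \<Rightarrow> real"
    by (simp add: j_def)
  have eq: "2 / 3 - 1 / 8 * (a + t) - (b + s) - q - q * (c + r) + K =
      2 / 3 - 1 / 8 * a - b - q - q * c + K - 1 / 8 * t - s - q * r"
    for a b c t s r q K :: real
    by (simp add: algebra_simps add_divide_distrib)
  from leibniz_tail_squares_shift[OF leibniz_tail_squares_shift[OF Suc.IH]]
  show ?case
    unfolding idx sum part j_def[symmetric] sumj u eq .
qed

section \<open>Return to Theta_1 and the five cases\<close>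

text \<open>Theta_1 is the series over all \<open>p\<close> without the terms
  \<open>p = 0, ..., m\<close>. Those are explicit, since a Leibniz tail is \<pi>/4 minus a finite
  sum up to sign.\<close>

lemma Theta1_sums:
  assumes "(\<lambda>p. 4 * leibniz_tail (p + d + 1) / (2 * real p + 1)\<^sup>2) sums v"
  shows "(\<lambda>k. Theta1_term m (m + d) (Suc k)) sums
    (v + (-1) ^ d * ((1 + (\<Sum>j=1..m. (-1) ^ j / (2 * real j + 1)\<^sup>2)) * pi
       - 4 * (1 + (\<Sum>j=1..d. (-1) ^ j / (2 * real j + 1)))
       - 4 * (\<Sum>k=1..m. \<Sum>j=0..k + d. (-1) ^ (j + k) / ((2 * real j + 1) * (2 * real k + 1)\<^sup>2))))"
proof -
  define F where "F p = 4 * leibniz_tail (p + d + 1) / (2 * real p + 1)\<^sup>2" for p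
  have F: "F p = (-1) ^ d * (4 * (\<Sum>j=0..p + d. (-1) ^ (j + p) / ((2 * real j + 1) * (2 * real p + 1)\<^sup>2))
      - (-1) ^ p / (2 * real p + 1)\<^sup>2 * pi)" for p
  proof -
    have "(\<Sum>j=0..p + d. (-1) ^ (j + p) / ((2 * real j + 1) * (2 * real p + 1)\<^sup>2)) =
        (-1) ^ p * (\<Sum>q<p + d + 1. (-1) ^ q / (2 * real q + 1)) / (2 * real p + 1)\<^sup>2"
      by (simp add: sum_distrib_left sum_divide_distrib power_add lessThan_Suc_atMost atLeast0AtMost mult_ac)
    then show ?thesis
      unfolding F_def leibniz_tail_def power_add by (simp add: algebra_simps diff_divide_distrib)
  qed
  \<comment> \<open>The term \<open>p = 0\<close> is kept apart: it supplies the 1 in the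
    coefficient of \<pi> and the single sum up to \<open>d\<close>, whereas the double sum starts at
    \<open>k = 1\<close>.\<close>
  have F0: "F 0 = (-1) ^ d * (4 * (1 + (\<Sum>j=1..d. (-1) ^ j / (2 * real j + 1))) - pi)"
    unfolding F by (simp add: sum.atLeast_Suc_atMost)
  have "{..<Suc m} = insert 0 {1..m}" by auto
  then have "(\<Sum>p<Suc m. F p) = F 0 + (\<Sum>p=1..m. F p)"
    by simp
  also have "(\<Sum>p=1..m. F p) = (-1) ^ d *
      (4 * (\<Sum>k=1..m. \<Sum>j=0..k + d. (-1) ^ (j + k) / ((2 * real j + 1) * (2 * real k + 1)\<^sup>2))
      - (\<Sum>j=1..m. (-1) ^ j / (2 * real j + 1)\<^sup>2) * pi)"
    by (simp only: F sum_distrib_left[symmetric] sum_distrib_right[symmetric] sum_subtractf)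
  finally have "(\<Sum>p<Suc m. F p) = - ((-1) ^ d * ((1 + (\<Sum>j=1..m. (-1) ^ j / (2 * real j + 1)\<^sup>2)) * pi
       - 4 * (1 + (\<Sum>j=1..d. (-1) ^ j / (2 * real j + 1)))
       - 4 * (\<Sum>k=1..m. \<Sum>j=0..k + d. (-1) ^ (j + k) / ((2 * real j + 1) * (2 * real k + 1)\<^sup>2))))"
    unfolding F0 by (simp add: algebra_simps)
  moreover have "(\<lambda>k. F (k + Suc m)) sums (v - (\<Sum>p<Suc m. F p))"
    using assms by (subst sums_iff_shift) (simp add: F_def[abs_def])
  moreover have "Theta1_term m (m + d) (Suc k) = F (k + Suc m)" for k
    unfolding Theta1_term_eq F_def by simp
  ultimately show ?thesis
    by simp
qed

theorem theorem3:
  fixes m n :: nat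
  assumes "0 < m" and "m \<le> n"
  shows
    "(n = m \<longrightarrow>
       (\<lambda>k. Theta1_term m n (Suc k)) sums
         (- 4 - 4 * (\<Sum>k=1..m. \<Sum>j=0..k. (-1) ^ (j + k) / ((2 * real j + 1) * (2 * real k + 1)\<^sup>2))
          + (1 + (\<Sum>j=1..m. (-1) ^ j / (2 * real j + 1)\<^sup>2) - catalan_G) * pi
          + pi\<^sup>2 / 4 * ln 2 + 7 / 4 * zeta 3)) \<and>
     (n = m + 1 \<longrightarrow>
       (\<lambda>k. Theta1_term m n (Suc k)) sums
         (5 / 3 + 4 * (\<Sum>k=1..m. \<Sum>j=0..k + 1. (-1) ^ (j + k) / ((2 * real j + 1) * (2 * real k + 1)\<^sup>2))
          - (1 + (\<Sum>j=1..m. (-1) ^ j / (2 * real j + 1)\<^sup>2) - catalan_G) * pi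
          + pi\<^sup>2 / 4 * (1 - ln 2) - 7 / 4 * zeta 3)) \<and>
     (n = m + 2 \<longrightarrow>
       (\<lambda>k. Theta1_term m n (Suc k)) sums
         (- 14 / 5 - 4 * (\<Sum>k=1..m. \<Sum>j=0..k + 2. (-1) ^ (j + k) / ((2 * real j + 1) * (2 * real k + 1)\<^sup>2))
          + (1 + (\<Sum>j=1..m. (-1) ^ j / (2 * real j + 1)\<^sup>2) - catalan_G) * pi
          + (ln 2 - 1 / 2) * (pi\<^sup>2 / 4) + 7 / 4 * zeta 3)) \<and>
     (odd (n - m) \<and> n - m \<noteq> 1 \<longrightarrow>
       (\<lambda>k. Theta1_term m n (Suc k)) sums
         (3 - 1 / 8 * (\<Sum>j=1..(n - m - 1) div 2.
                (4 * real j + 1) * (harm (2 * j - 1) - 2 * harm (4 * j - 1))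
                  / ((real j)\<^sup>2 * (2 * real j + 1)\<^sup>2))
          - (\<Sum>j=1..(n - m - 1) div 2. 1 / ((2 * real j + 1)\<^sup>2 * (4 * real j + 1)))
          - 4 * (\<Sum>k=1..m. \<Sum>j=0..k + n - m.
                (-1) ^ (k + n - m + j) / ((2 * real k + 1)\<^sup>2 * (2 * real j + 1)))
          + 4 * (\<Sum>j=1..n - m. (-1) ^ j / (2 * real j + 1))
          + (- 1 - (\<Sum>j=1..m. (-1) ^ (j + n - m - 1) / (2 * real j + 1)\<^sup>2) + catalan_G) * pi
          + (1 - ln 2 - 1 / 2 * (\<Sum>j=1..(n - m - 1) div 2. 1 / (real j * (2 * real j + 1))))
              * (pi\<^sup>2 / 4)
          - 7 / 4 * zeta 3)) \<and>
     (even (n - m) \<and> n - m \<ge> 4 \<longrightarrow>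
       (\<lambda>k. Theta1_term m n (Suc k)) sums
         (- 10 / 3 - 1 / 8 * (\<Sum>j=1..(n - m - 2) div 2.
                (4 * real j + 3) * (harm (2 * j - 1) - 2 * harm (4 * j - 1))
                  / ((real j + 1)\<^sup>2 * (2 * real j + 1)\<^sup>2))
          - (\<Sum>j=1..(n - m - 2) div 2.
                (4 * (real j) ^ 3 + (real j)\<^sup>2 - 4 * real j - 2)
                  / ((real j + 1)\<^sup>2 * (2 * real j + 1)\<^sup>2 * (4 * real j + 3) * (4 * real j + 1)))
          - 4 * (\<Sum>k=1..m. \<Sum>j=0..k + n - m.
                (-1) ^ (k + n - m + j) / ((2 * real k + 1)\<^sup>2 * (2 * real j + 1)))
          - 4 * (\<Sum>j=1..n - m. (-1) ^ j / (2 * real j + 1))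
          - (- 1 + (\<Sum>j=1..m. (-1) ^ (j + n - m - 1) / (2 * real j + 1)\<^sup>2) + catalan_G) * pi
          + pi\<^sup>2 / 4 * (ln 2 - 1 / 2)
          - pi\<^sup>2 / 8 * (\<Sum>j=1..(n - m - 2) div 2. 1 / ((real j + 1) * (2 * real j + 1)))
          + 7 / 4 * zeta 3))"
proof -
  obtain d where n: "n = m + d"
    using \<open>m \<le> n\<close> le_Suc_ex by blast
  define A where "A = (\<Sum>j=1..m. (-1) ^ j / (2 * real j + 1)\<^sup>2)"
  define B where "B = (\<Sum>j=1..d. (-1) ^ j / (2 * real j + 1))"
  define D where "D = (\<Sum>k=1..m. \<Sum>j=0..k + d. (-1) ^ (j + k) / ((2 * real j + 1) * (2 * real k + 1)\<^sup>2))"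
  \<comment> \<open>As \<open>j\<close> is at least 1, the truncated exponent is the true
    \<open>j + d - 1\<close>, whose parity gives the sign \<open>- ((-1) ^ d)\<close>.\<close>
  have A': "(\<Sum>j=1..m. (-1) ^ (j + n - m - 1) / (2 * real j + 1)\<^sup>2) = - ((-1) ^ d) * A"
    unfolding A_def sum_distrib_left
  proof (rule sum.cong)
    fix j assume "j \<in> {1..m}"
    then obtain i where "j = Suc i"
      by (cases j) auto
    then show "(-1) ^ (j + n - m - 1) / (2 * real j + 1)\<^sup>2 = - ((-1) ^ d) * ((-1) ^ j / (2 * real j + 1)\<^sup>2)"
      by (simp add: n power_add)
  qed simp
  have D': "(\<Sum>k=1..m. \<Sum>j=0..k + n - m. (-1) ^ (k + n - m + j) / ((2 * real k + 1)\<^sup>2 * (2 * real j + 1)))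
      = (-1) ^ d * D"
    unfolding D_def sum_distrib_left by (intro sum.cong) (simp_all add: n power_add mult_ac)
  have Theta: "(\<lambda>k. Theta1_term m n (Suc k)) sums w"
    if "(\<lambda>p. 4 * leibniz_tail (p + d + 1) / (2 * real p + 1)\<^sup>2) sums v"
      and "w = v + (-1) ^ d * ((1 + A) * pi - 4 * (1 + B) - 4 * D)" for v w
    using Theta1_sums[OF that(1), of m] that(2) by (simp only: n A_def B_def D_def)
  show ?thesis
  proof (intro conjI impI, goal_cases)
    case 1
    then have d: "d = 0"
      by (simp add: n)
    show ?case
      \<comment> \<open>Here \<open>B = 0\<close>, so the rational constant is
        \<open>-4 * (1 + B) = -4\<close>.\<close>
      by (rule Theta[OF leibniz_tail_squares_sums_0[folded d]], unfold A_def[symmetric])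
        (simp add: d D_def B_def Theta1_const_def algebra_simps add_divide_distrib diff_divide_distrib)
  next
    case 2
    then have d: "d = 2 * 0 + 1"
      by (simp add: n)
    have D: "D = (\<Sum>k=1..m. \<Sum>j=0..k + 1. (-1) ^ (j + k) / ((2 * real j + 1) * (2 * real k + 1)\<^sup>2))"
      by (simp add: D_def d)
    \<comment> \<open>The constant becomes \<open>-1 + 4 * (1 - 1/3) = 5/3\<close>.\<close>
    have B: "B = - 1 / 3"
      by (simp add: B_def d)
    have "(-1) ^ d = (- 1 :: real)"
      by (simp add: d)
    then show ?case
      by (intro Theta[OF leibniz_tail_squares_sums_odd[of 0, folded d]], unfold A_def[symmetric] D[symmetric] B)
        (simp add: Theta1_const_def algebra_simps add_divide_distrib diff_divide_distrib)
  next
    case 3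
    then have d: "d = 2 * 0 + 2"
      by (simp add: n)
    have D: "D = (\<Sum>k=1..m. \<Sum>j=0..k + 2. (-1) ^ (j + k) / ((2 * real j + 1) * (2 * real k + 1)\<^sup>2))"
      by (simp add: D_def d)
    \<comment> \<open>The constant becomes \<open>2/3 - 4 * (1 - 2/15) = -14/5\<close>.\<close>
    have B: "B = - 2 / 15"
      by (simp add: B_def d numeral_2_eq_2)
    have "(-1) ^ d = (1 :: real)"
      by (simp add: d)
    then show ?case
      by (intro Theta[OF leibniz_tail_squares_sums_even[of 0, folded d]], unfold A_def[symmetric] D[symmetric] B)
        (simp add: Theta1_const_def algebra_simps add_divide_distrib diff_divide_distrib)
  next
    case 4
    then obtain L where d: "d = 2 * L + 1"
      by (auto simp: n elim: oddE)
    have nm: "n - m = d" and L: "(d - 1) div 2 = L" and sgn: "(-1) ^ d = (- 1 :: real)"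
      by (simp_all add: n d)
    \<comment> \<open>\<open>B\<close> stays symbolic here, so the constant is
      \<open>-1 + 4 = 3\<close>.\<close>
    show ?case
      unfolding nm L A' D' sgn B_def[symmetric]
      by (rule Theta[OF leibniz_tail_squares_sums_odd[of L, folded d]])
        (simp only: sgn, simp add: Theta1_const_def algebra_simps add_divide_distrib diff_divide_distrib)
  next
    case 5
    then have "even d" "d \<ge> 4"
      by (simp_all add: n)
    then obtain k where k: "d = 2 * k" "k \<ge> 2"
      by (auto elim: evenE)
    define L where "L = k - 1"
    have d: "d = 2 * L + 2"
      using k by (simp add: L_def)
    have nm: "n - m = d" and L: "(d - 2) div 2 = L" and sgn: "(-1) ^ d = (1 :: real)"
      by (simp_all add: n d)
    \<comment> \<open>Again \<open>B\<close> stays symbolic, and the constant is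
      \<open>2/3 - 4 = -10/3\<close>.\<close>
    show ?case
      unfolding nm L A' D' sgn B_def[symmetric]
      by (rule Theta[OF leibniz_tail_squares_sums_even[of L, folded d]])
        (simp only: sgn, simp add: Theta1_const_def algebra_simps add_divide_distrib diff_divide_distrib)
  qed
qed

end
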